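(* Let $G$ be a $(d_1,d_2)$-polynomial graph. Then for any $\eta\in(0,1)$ there exists $c>0$ such that for any vertex $v$ of $G$ and any integer $n$: $$\mathrm{Sep}^v_G(n)\ \ge\ c\, n^{(1-\eta)\frac{d_1^2(d_1-1)}{d_2^3}} .$$
   Context: A graph $G$ has vertex set $VG$ and edge set $EG\subset VG\times VG$. For $A\subset VG$, the boundary is $\partial A=\{(a,b)\in EG : \text{exactly one of } a,b \text{ lies in } A\}$. $B_G(v,r)$ is the ball of radius $r$ centred at $v$ for the combinatorial distance. For positive reals $d_1,d_2$, a graph $G$ is $(d_1,d_2)$-polynomial if there exist $b,g>0$ such that: for any vertex $v$ and any positive integer $n$, $|B_G(v,n)|\le b n^{d_2}$; and for any finite nonempty $V\subset VG$, $|\partial V|\ge g|V|^{\frac{d_1-1}{d_1}}$. For a finite graph $H$, the Cheeger constant is $h(H)=\min\{|\partial_H A|/|A| : \emptyset\ne A\subset VH,\ |A|\le |VH|/2\}$, where $\partial_H$ is the boundary in $H$. For a finite $F\subset VG$, $h(F)$ is the Cheeger constant of the subgraph of $G$ induced on $F$. The local separation profile at a vertex $v$ is $\mathrm{Sep}^v_G(n)=\sup\{|F|\,h(F) : F\subset B_G(v,r) \text{ for some } r \text{ with } |B_G(v,r)|\le n\}$. *)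

theory Defs
  imports
    Complex_Main
    "Graph_Theory.Graph_Theory"
begin

text \<open>
  A graph is a pair of a vertex set and a set of edges contained in its square
  (\<open>pair_wf_digraph\<close>).  No symmetry of the edge set is required; adjacency and distance ignore
  orientation, hence the use of \<open>mk_symmetric\<close>, which does nothing when the edge set is already
  symmetric.
\<close>

definition graph_dist :: "('a, 'b) pre_digraph \<Rightarrow> 'a \<Rightarrow> 'a \<Rightarrow> ereal" where
  "graph_dist G u v = wf_digraph.\<mu> (with_proj (mk_symmetric G)) (\<lambda>_. 1) u v"

definition graph_ball :: "('a, 'b) pre_digraph \<Rightarrow> 'a \<Rightarrow> nat \<Rightarrow> 'a set" where
  "graph_ball G v r = {u \<in> verts G. graph_dist G v u \<le> ereal (real r)}"

definition edge_boundary :: "('a, 'b) pre_digraph \<Rightarrow> 'a set \<Rightarrow> 'b set" where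
  "edge_boundary G A = {e \<in> arcs G. (tail G e \<in> A) \<noteq> (head G e \<in> A)}"

text \<open>
  Balls are explicitly required to be finite, since \<open>card\<close> of an infinite set is 0.  With
  radius 1 this bounds all degrees, so the boundaries below are finite as well.
\<close>

definition polynomial_graph :: "real \<Rightarrow> real \<Rightarrow> ('a, 'b) pre_digraph \<Rightarrow> bool" where
  "polynomial_graph d1 d2 G \<longleftrightarrow>
     (\<exists>b>0. \<exists>g>0.
        (\<forall>v\<in>verts G. \<forall>n::nat. n \<ge> 1 \<longrightarrow>
           finite (graph_ball G v n) \<and> real (card (graph_ball G v n)) \<le> b * real n powr d2) \<and>
        (\<forall>V\<subseteq>verts G. finite V \<and> V \<noteq> {} \<longrightarrow>
           real (card (edge_boundary G V)) \<ge> g * real (card V) powr ((d1 - 1) / d1)))"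

text \<open>
  Cheeger constant of a finite graph.  With at most one vertex there is no admissible \<open>A\<close> and
  the minimum is undefined; the value 1 is a convention.  It makes a singleton contribute 1 to the
  separation profile, which is at most what two adjacent vertices contribute, so it affects
  \<open>sep_profile G v n\<close> only when the balls around \<open>v\<close> of size at most \<open>n\<close> contain no edge
  between distinct vertices.
  (The value 0 would make the profile vanish for those \<open>n\<close>, and \<open>\<infinity>\<close> would make it infinite for
  every \<open>n \<ge> 1\<close>.)
\<close>

definition cheeger :: "('a, 'b) pre_digraph \<Rightarrow> real" where
  "cheeger H =
     (if card (verts H) \<le> 1 then 1
      else Min ((\<lambda>A. real (card (edge_boundary H A)) / real (card A)) `
             {A. A \<subseteq> verts H \<and> A \<noteq> {} \<and> real (card A) \<le> real (card (verts H)) / 2}))"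

text \<open>
  For \<open>n \<ge> 1\<close> and a vertex \<open>v\<close> of a graph without parallel edges, the set is nonempty
  (take the ball of radius 0) and bounded above in terms of \<open>n\<close>, so the real supremum is
  the intended one.
\<close>

definition sep_profile :: "('a, 'b) pre_digraph \<Rightarrow> 'a \<Rightarrow> nat \<Rightarrow> real" where
  "sep_profile G v n =
     Sup {real (card F) * cheeger (G \<restriction> F) | F.
            \<exists>r. F \<subseteq> graph_ball G v r \<and> finite (graph_ball G v r) \<and> card (graph_ball G v r) \<le> n}"

end

theory Submission
  imports Defs "HOL-Real_Asymp.Real_Asymp"
begin

text \<open>
  Let \<open>B\<close> be a ball of radius \<open>R\<close>, about \<open>n powr (1 / d2)\<close>, and let \<open>\<phi> s\<close> be the least ratio
  \<open>card (\<partial>A) / card A\<close> over nonempty \<open>A \<subseteq> B\<close> with at most \<open>s\<close> vertices.  If \<open>F\<close> attains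
  \<open>\<phi> (2 * s)\<close>, then comparing \<open>\<partial>F\<close> with \<open>\<partial>A\<close> and \<open>\<partial>(F - A)\<close> gives
  \<open>h(F) \<ge> (\<phi> s - \<phi> (2 * s)) / 2\<close>.  Polynomial growth makes the final value \<open>\<phi>\<^sub>0 = \<phi> (card B)\<close> at most
  \<open>C * R powr (\<epsilon> - 1)\<close>, whereas \<open>\<phi> 1 \<ge> g\<close>; hence beyond the last dyadic \<open>s\<close> with
  \<open>\<phi> s \<ge> 2 * \<phi>\<^sub>0\<close> some doubling step loses at least \<open>\<phi>\<^sub>0 / log 2 n\<close>.  The optimal \<open>F\<close> of that
  step has ratio less than \<open>2 * \<phi>\<^sub>0\<close>, hence by isoperimetry at least \<open>(g / (2 * \<phi>\<^sub>0)) powr d1\<close>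
  vertices.  This yields the exponent \<open>(1 - \<eta>) * (d1 - 1) / d2\<close>, which is at least the claimed one
  because \<open>d1 \<le> d2\<close>.  For \<open>d1 \<le> 1\<close> a single vertex suffices.
\<close>

section \<open>Balls and adjacency\<close>

context pair_wf_digraph begin

lemma graph_ball_subset_verts: "graph_ball G v r \<subseteq> pverts G"
  by (auto simp: graph_ball_def)

lemma centre_in_graph_ball:
  assumes "v \<in> pverts G"
  shows "v \<in> graph_ball G v r"
proof -
  interpret S: pair_wf_digraph "mk_symmetric G"
    by (rule wellformed_mk_symmetric)
  have "S.\<mu> (\<lambda>_. 1) v v \<le> awalk_cost (\<lambda>_. 1) ([] :: ('a \<times> 'a) list)"
    using assms by (intro S.min_cost_le_walk_cost) (simp add: S.awalk_Nil_iff)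
  also have "\<dots> \<le> ereal (real r)"
    by simp
  finally show ?thesis
    using assms by (simp add: graph_ball_def graph_dist_def)
qed

text \<open>Appending one arc to a walk from \<open>v\<close> to \<open>u\<close> adds 1 to its
  cost. Walks live in \<open>mk_symmetric G\<close>, so either orientation of the arc will
  do.\<close>

lemma neighbour_in_graph_ball_Suc:
  assumes u: "u \<in> graph_ball G v r" and uw: "(u, w) \<in> parcs G \<or> (w, u) \<in> parcs G"
  shows "w \<in> graph_ball G v (Suc r)"
proof -
  interpret S: pair_wf_digraph "mk_symmetric G"
    by (rule wellformed_mk_symmetric)
  have arc: "(u, w) \<in> parcs (mk_symmetric G)"
    using uw unfolding parcs_mk_symmetric by (elim disjE; intro UN_I) auto
  have w: "w \<in> pverts G"
    using uw arc_fst_in_verts arc_snd_in_verts by force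
  \<comment> \<open>The 1 is moved to the left so that the bound can be checked walk by walk under
    the infimum.\<close>
  have "S.\<mu> (\<lambda>_. 1) v w - 1 \<le> S.\<mu> (\<lambda>_. 1) v u"
    unfolding S.\<mu>_def[of _ v u]
  proof (rule INF_greatest)
    fix p assume "p \<in> {p. S.awalk v p u}"
    then have "S.awalk v (p @ [(u, w)]) w"
      using arc w by (auto simp: S.awalk_simps)
    then have "S.\<mu> (\<lambda>_. 1) v w \<le> awalk_cost (\<lambda>_. 1) (p @ [(u, w)])"
      by (rule S.min_cost_le_walk_cost)
    then show "S.\<mu> (\<lambda>_. 1) v w - 1 \<le> ereal (awalk_cost (\<lambda>_. 1) p)"
      by (simp add: ereal_minus_le one_ereal_def)
  qed
  also have "\<dots> \<le> ereal (real r)"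
    using u by (simp add: graph_ball_def graph_dist_def)
  finally have "S.\<mu> (\<lambda>_. 1) v w \<le> ereal (real (Suc r))"
    by (simp add: ereal_minus_le one_ereal_def add.commute)
  then show ?thesis
    using w by (simp add: graph_ball_def graph_dist_def)
qed

end

lemma graph_ball_mono: "r \<le> s \<Longrightarrow> graph_ball G v r \<subseteq> graph_ball G v s"
  by (auto simp: graph_ball_def intro: order_trans)

section \<open>Boundaries and the Cheeger constant of an induced subgraph\<close>

text \<open>Arcs between \<open>A\<close> and \<open>F - A\<close> (the set \<open>I\<close>) lie in
  both boundaries on the left and not in that of \<open>F\<close>; all other arcs of the two
  boundaries leave \<open>F\<close> and lie in exactly one of them.\<close>

lemma card_edge_boundary_split:
  assumes "A \<subseteq> F" and "finite (edge_boundary G A)" and "finite (edge_boundary G (F - A))"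
  shows "card (edge_boundary G A) + card (edge_boundary G (F - A))
    = card (edge_boundary G F) + 2 * card (edge_boundary (G \<restriction> F) A)"
proof -
  define I where "I = edge_boundary (G \<restriction> F) A"
  define X where "X = edge_boundary G A \<inter> edge_boundary G F"
  define Y where "Y = edge_boundary G (F - A) \<inter> edge_boundary G F"
  have eqs: "edge_boundary G A = X \<union> I" "edge_boundary G (F - A) = Y \<union> I"
      "edge_boundary G F = X \<union> Y" "X \<inter> I = {}" "Y \<inter> I = {}" "X \<inter> Y = {}"
    using \<open>A \<subseteq> F\<close> by (auto simp: edge_boundary_def X_def Y_def I_def)
  moreover have "finite X" "finite Y" "finite I"
    using assms(2,3) eqs(1,2) by (metis finite_Un)+
  ultimately show ?thesis
    by (simp add: card_Un_disjoint flip: I_def)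
qed

text \<open>
  The bounds on \<open>\<partial>A\<close> and \<open>\<partial>(F - A)\<close> add up to \<open>q * card F + \<delta> * card A\<close>, so
  \<open>\<delta> * card A\<close> is at most twice the boundary of \<open>A\<close> inside \<open>F\<close>.
\<close>

lemma cheeger_induce_subgraph_ge:
  assumes fin: "finite F"
    and fb: "\<And>A. A \<subseteq> F \<Longrightarrow> finite (edge_boundary G A)"
    and small: "\<And>A. A \<subseteq> F \<Longrightarrow> A \<noteq> {} \<Longrightarrow> 2 * card A \<le> card F \<Longrightarrow>
        (q + \<delta>) * real (card A) \<le> real (card (edge_boundary G A))"
    and all: "\<And>A. A \<subseteq> F \<Longrightarrow> A \<noteq> {} \<Longrightarrow>
        q * real (card A) \<le> real (card (edge_boundary G A))"
    and opt: "real (card (edge_boundary G F)) \<le> q * real (card F)"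
    and "\<delta> \<le> 2"
  shows "\<delta> / 2 \<le> cheeger (G \<restriction> F)"
proof (cases "card F \<le> 1")
  case True
  \<comment> \<open>Here \<open>cheeger\<close> has its conventional value 1, which is where
    \<open>\<delta> \<le> 2\<close> enters.\<close>
  then show ?thesis
    using \<open>\<delta> \<le> 2\<close> by (simp add: cheeger_def)
next
  case False
  let ?\<A> = "{A. A \<subseteq> F \<and> A \<noteq> {} \<and> real (card A) \<le> real (card F) / 2}"
  from False fin obtain x where "x \<in> F"
    by fastforce
  then have "{x} \<in> ?\<A>"
    using False by simp
  moreover have "finite ?\<A>"
    using fin by simp
  moreover have "\<delta> / 2 \<le> real (card (edge_boundary (G \<restriction> F) A)) / real (card A)" if "A \<in> ?\<A>" for A
  proof -
    from that have A: "A \<subseteq> F" "A \<noteq> {}" "2 * card A \<le> card F"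
      by auto
    have "finite A"
      using A fin finite_subset by blast
    then have pos: "card A > 0"
      using A by (simp add: card_gt_0_iff)
    have "F - A \<noteq> {}"
      using A pos by auto
    have cd: "real (card (F - A)) = real (card F) - real (card A)"
      using A \<open>finite A\<close> fin by (simp add: card_Diff_subset card_mono)
    have "real (card (edge_boundary G A)) + real (card (edge_boundary G (F - A)))
      = real (card (edge_boundary G F)) + 2 * real (card (edge_boundary (G \<restriction> F) A))"
      using card_edge_boundary_split[OF A(1), of G] fb[of A] fb[of "F - A"] A(1)
      by (metis Diff_subset of_nat_add of_nat_mult of_nat_numeral)
    moreover have "q * (real (card F) - real (card A)) \<le> real (card (edge_boundary G (F - A)))"
      using all[of "F - A"] \<open>F - A \<noteq> {}\<close> cd by auto
    ultimately have "\<delta> * real (card A) \<le> 2 * real (card (edge_boundary (G \<restriction> F) A))"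
      using small[OF A] opt by (simp add: algebra_simps)
    then show ?thesis
      using pos by (simp add: field_simps)
  qed
  ultimately have "\<delta> / 2 \<le> Min ((\<lambda>A. real (card (edge_boundary (G \<restriction> F) A)) / real (card A)) ` ?\<A>)"
    by (intro Min.boundedI) blast+
  then show ?thesis
    using False by (simp add: cheeger_def)
qed

section \<open>The dyadic argument on the local isoperimetric profile\<close>

text \<open>The losses telescope to \<open>f i - f n\<close>, so not all \<open>n - i\<close> of
  them can be below \<open>c / real (n - i)\<close>.\<close>

lemma exists_step_ge_average:
  fixes f :: "nat \<Rightarrow> real"
  assumes "i < n" and "c \<le> f i - f n"
  shows "\<exists>k\<in>{i..<n}. c / real (n - i) \<le> f k - f (Suc k)"
proof (rule ccontr)
  assume "\<not> ?thesis"
  then have "(\<Sum>k\<in>{i..<n}. f k - f (Suc k)) < (\<Sum>k\<in>{i..<n}. c / real (n - i))"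
    using assms(1) by (intro sum_strict_mono) (auto simp: not_le)
  also have "\<dots> = c"
    using assms(1) by simp
  also have "(\<Sum>k\<in>{i..<n}. f k - f (Suc k)) = f i - f n"
    using sum_Suc_diff'[of i n f] assms(1) by (simp add: sum_subtractf)
  finally show False
    using assms(2) by simp
qed

definition iso_ratio :: "('a, 'b) pre_digraph \<Rightarrow> 'a set \<Rightarrow> real" where
  "iso_ratio G A = real (card (edge_boundary G A)) / real (card A)"

text \<open>Boundaries are taken in all of \<open>G\<close> and not inside \<open>B\<close>, so that
  the isoperimetric inequality of \<open>G\<close> applies to every competitor.\<close>

definition local_iso_profile :: "('a, 'b) pre_digraph \<Rightarrow> 'a set \<Rightarrow> nat \<Rightarrow> real" where
  "local_iso_profile G B s = Min (iso_ratio G ` {A. A \<subseteq> B \<and> A \<noteq> {} \<and> card A \<le> s})"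

text \<open>The isoperimetric inequality divided by \<open>card A\<close>; in this form a small
  ratio forces a large set.\<close>

lemma iso_ratio_ge:
  fixes g d :: real
  assumes "card A > 0" "d > 0"
    and "g * real (card A) powr ((d - 1) / d) \<le> real (card (edge_boundary G A))"
  shows "g * real (card A) powr (- 1 / d) \<le> iso_ratio G A"
proof -
  have "g * real (card A) powr (- 1 / d) * real (card A) = g * real (card A) powr (- 1 / d + 1)"
    using assms(1) by (subst powr_add) simp
  also have "- 1 / d + 1 = (d - 1) / d"
    using \<open>d > 0\<close> by (simp add: field_simps)
  finally show ?thesis
    using assms(1,3) unfolding iso_ratio_def by (subst pos_le_divide_eq) linarith+
qed

lemma local_iso_profile_le:
  assumes "finite B" "A \<subseteq> B" "A \<noteq> {}" "card A \<le> s"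
  shows "local_iso_profile G B s \<le> iso_ratio G A"
  unfolding local_iso_profile_def using assms by (intro Min_le) auto

lemma local_iso_profile_attained:
  assumes "finite B" "B \<noteq> {}" "s \<ge> 1"
  obtains A where "A \<subseteq> B" "A \<noteq> {}" "card A \<le> s" "local_iso_profile G B s = iso_ratio G A"
proof -
  let ?\<A> = "{A. A \<subseteq> B \<and> A \<noteq> {} \<and> card A \<le> s}"
  from \<open>B \<noteq> {}\<close> obtain x where "x \<in> B"
    by blast
  then have "{x} \<in> ?\<A>"
    using \<open>s \<ge> 1\<close> by simp
  then have "iso_ratio G ` ?\<A> \<noteq> {}"
    by blast
  moreover have "finite ?\<A>"
    using \<open>finite B\<close> by simp
  ultimately have "local_iso_profile G B s \<in> iso_ratio G ` ?\<A>"
    unfolding local_iso_profile_def by (intro Min_in) auto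
  then show thesis
    using that by auto
qed

lemma local_iso_profile_antimono:
  assumes "finite B" "B \<noteq> {}" "1 \<le> s" "s \<le> t"
  shows "local_iso_profile G B t \<le> local_iso_profile G B s"
proof -
  obtain A where "A \<subseteq> B" "A \<noteq> {}" "card A \<le> s" "local_iso_profile G B s = iso_ratio G A"
    using local_iso_profile_attained[OF assms(1-3)] .
  then show ?thesis
    using local_iso_profile_le[of B A t G] assms by simp
qed

text \<open>Between the last scale with profile at least \<open>2 * \<phi>\<close> and scale
  \<open>J\<close>, where it equals \<open>\<phi>\<close>, some doubling loses at least
  \<open>\<phi> / J\<close>. The minimiser \<open>F\<close> after that doubling has a large Cheeger
  constant because of the loss, and many vertices because its ratio is below
  \<open>2 * \<phi>\<close>.\<close>

lemma exists_subset_cheeger_ge: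
  fixes g d :: real
  assumes fin: "finite B" and ne: "B \<noteq> {}"
    and fb: "\<And>A. A \<subseteq> B \<Longrightarrow> finite (edge_boundary G A)"
    and "d > 0" "g > 0"
    and iso: "\<And>A. A \<subseteq> B \<Longrightarrow> A \<noteq> {} \<Longrightarrow>
        g * real (card A) powr ((d - 1) / d) \<le> real (card (edge_boundary G A))"
    and J: "card B \<le> 2 ^ J"
    and \<phi>: "\<phi> = local_iso_profile G B (card B)" "\<phi> \<le> g / 2" "\<phi> \<le> 1"
  shows "\<exists>F\<subseteq>B. (g / (2 * \<phi>)) powr d * (\<phi> / (2 * real J)) \<le> real (card F) * cheeger (G \<restriction> F)"
proof -
  define \<psi> where "\<psi> j = local_iso_profile G B (2 ^ j)" for j
  have ratio: "g * real (card A) powr (- 1 / d) \<le> iso_ratio G A" if "A \<subseteq> B" "A \<noteq> {}" for A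
    using that fin iso \<open>d > 0\<close> by (intro iso_ratio_ge) (auto simp: card_gt_0_iff finite_subset)
  have cB: "card B \<ge> 1"
    using fin ne by (simp add: Suc_leI card_gt_0_iff)
  have "\<phi> > 0"
  proof -
    obtain A where A: "A \<subseteq> B" "A \<noteq> {}" "\<phi> = iso_ratio G A"
      unfolding \<phi>(1) using local_iso_profile_attained[OF fin ne cB, of G] by blast
    then have "card A > 0"
      using fin by (simp add: card_gt_0_iff finite_subset)
    then have "0 < g * real (card A) powr (- 1 / d)"
      using \<open>g > 0\<close> by simp
    then show ?thesis
      using ratio[OF A(1,2)] A(3) by simp
  qed
  \<comment> \<open>The size bounds \<open>card B\<close> and \<open>2 ^ J\<close> both admit every
    nonempty subset of \<open>B\<close>.\<close>
  have \<psi>J: "\<psi> J = \<phi>"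
  proof (rule antisym)
    show "\<psi> J \<le> \<phi>"
      using local_iso_profile_antimono[OF fin ne cB J] by (simp add: \<psi>_def \<phi>)
    obtain A where A: "A \<subseteq> B" "A \<noteq> {}" "\<psi> J = iso_ratio G A"
      unfolding \<psi>_def using local_iso_profile_attained[OF fin ne, of "2 ^ J" G] by auto
    then show "\<phi> \<le> \<psi> J"
      using local_iso_profile_le[OF fin A(1,2)] fin card_mono[OF fin A(1)] by (simp add: \<phi>)
  qed
  \<comment> \<open>At scale 0 only singletons compete, and their ratio is at least
    \<open>g\<close>.\<close>
  have \<psi>0: "\<psi> 0 \<ge> 2 * \<phi>"
  proof -
    obtain A where A: "A \<subseteq> B" "A \<noteq> {}" "card A \<le> 1" "\<psi> 0 = iso_ratio G A"
      unfolding \<psi>_def using local_iso_profile_attained[OF fin ne, of 1 G] by auto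
    moreover have "card A > 0"
      using A fin by (simp add: card_gt_0_iff finite_subset)
    ultimately have "g \<le> \<psi> 0"
      using ratio[OF A(1,2)] by (simp add: le_Suc_eq)
    then show ?thesis
      using \<phi>(2) by simp
  qed
  \<comment> \<open>Taking the last such index keeps every later ratio below
    \<open>2 * \<phi>\<close>, while the total drop from \<open>i\<close> to \<open>J\<close> is
    still at least \<open>\<phi>\<close>.\<close>
  define i where "i = Max {j. j \<le> J \<and> 2 * \<phi> \<le> \<psi> j}"
  have "i \<in> {j. j \<le> J \<and> 2 * \<phi> \<le> \<psi> j}"
    unfolding i_def using \<psi>0 by (intro Max_in) auto
  then have i: "i \<le> J" "2 * \<phi> \<le> \<psi> i"
    by auto
  have i_max: "\<psi> j < 2 * \<phi>" if "i < j" "j \<le> J" for j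
  proof (rule ccontr)
    assume "\<not> \<psi> j < 2 * \<phi>"
    then have "j \<le> i"
      unfolding i_def using that by (intro Max_ge) auto
    then show False
      using that by simp
  qed
  have "i \<noteq> J"
    using i \<psi>J \<open>\<phi> > 0\<close> by auto
  then have "i < J"
    using i by simp
  then obtain k where k: "k \<in> {i..<J}" "\<phi> / real (J - i) \<le> \<psi> k - \<psi> (Suc k)"
    using exists_step_ge_average[of i J \<phi> \<psi>] i \<psi>J by auto
  define \<delta> where "\<delta> = \<phi> / real J"
  have "\<delta> \<le> \<phi> / real (J - i)"
    unfolding \<delta>_def using \<open>i < J\<close> \<open>\<phi> > 0\<close> by (intro divide_left_mono) auto
  then have \<delta>: "\<psi> (Suc k) + \<delta> \<le> \<psi> k"
    using k by simp
  obtain F where F: "F \<subseteq> B" "F \<noteq> {}" "card F \<le> 2 ^ Suc k" "\<psi> (Suc k) = iso_ratio G F"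
    unfolding \<psi>_def using local_iso_profile_attained[OF fin ne, of "2 ^ Suc k" G] by auto
  have "finite F"
    using F fin finite_subset by blast
  have cardpos: "card A > 0" if "A \<subseteq> F" "A \<noteq> {}" for A
    using that \<open>finite F\<close> by (simp add: card_gt_0_iff finite_subset)
  have che: "\<delta> / 2 \<le> cheeger (G \<restriction> F)"
  proof (rule cheeger_induce_subgraph_ge[where q = "\<psi> (Suc k)"])
    fix A assume A: "A \<subseteq> F" "A \<noteq> {}" "2 * card A \<le> card F"
    \<comment> \<open>Half of at most \<open>2 ^ Suc k\<close> vertices is at most
      \<open>2 ^ k\<close>, so \<open>A\<close> competes already at scale \<open>k\<close>.\<close>
    have "\<psi> k \<le> iso_ratio G A"
      unfolding \<psi>_def using A F by (intro local_iso_profile_le[OF fin]) auto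
    then have "\<psi> (Suc k) + \<delta> \<le> iso_ratio G A"
      using \<delta> by simp
    then show "(\<psi> (Suc k) + \<delta>) * real (card A) \<le> real (card (edge_boundary G A))"
      using cardpos[OF A(1,2)] by (simp add: iso_ratio_def pos_le_divide_eq)
  next
    fix A assume A: "A \<subseteq> F" "A \<noteq> {}"
    have "\<psi> (Suc k) \<le> iso_ratio G A"
      unfolding \<psi>_def using A F card_mono[OF \<open>finite F\<close> A(1)]
      by (intro local_iso_profile_le[OF fin]) auto
    then show "\<psi> (Suc k) * real (card A) \<le> real (card (edge_boundary G A))"
      using cardpos[OF A(1,2)] by (simp add: iso_ratio_def pos_le_divide_eq)
  next
    show "real (card (edge_boundary G F)) \<le> \<psi> (Suc k) * real (card F)"
      using F cardpos[of F] by (simp add: iso_ratio_def)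
    have "\<phi> / real J \<le> \<phi> / 1"
      using \<open>i < J\<close> \<open>\<phi> > 0\<close> by (intro divide_left_mono) auto
    then show "\<delta> \<le> 2"
      using \<phi>(3) by (simp add: \<delta>_def)
  qed (use F fb \<open>finite F\<close> in auto)
  \<comment> \<open>Since \<open>Suc k > i\<close>, the ratio of \<open>F\<close> is below
    \<open>2 * \<phi>\<close>; isoperimetry turns this into a lower bound on
    \<open>card F\<close>.\<close>
  have "g * real (card F) powr (- 1 / d) \<le> 2 * \<phi>"
    using ratio[OF F(1,2)] F(4) i_max[of "Suc k"] k by auto
  then have "g / (2 * \<phi>) \<le> real (card F) powr (1 / d)"
    using \<open>\<phi> > 0\<close> cardpos[of F] F(2) by (simp add: powr_minus field_simps)
  then have "(g / (2 * \<phi>)) powr d \<le> (real (card F) powr (1 / d)) powr d"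
    using \<open>d > 0\<close> \<open>\<phi> > 0\<close> \<open>g > 0\<close> by (intro powr_mono2) auto
  also have "\<dots> = real (card F)"
    using \<open>d > 0\<close> by (simp add: powr_powr)
  finally have "(g / (2 * \<phi>)) powr d * (\<delta> / 2) \<le> real (card F) * cheeger (G \<restriction> F)"
    using che \<open>\<phi> > 0\<close> by (intro mult_mono) (auto simp: \<delta>_def)
  then show ?thesis
    using F(1) by (auto simp: \<delta>_def mult.commute)
qed

section \<open>Degrees, boundaries of balls and ball growth\<close>

context pair_wf_digraph begin

text \<open>Without parallel arcs, an arc at \<open>u\<close> is determined by its direction and its
  other endpoint, which is within distance 1. So the size of unit balls controls the
  degrees.\<close>

lemma incident_arcs_subset:
  "{e \<in> parcs G. fst e = u \<or> snd e = u}
    \<subseteq> Pair u ` graph_ball G u 1 \<union> (\<lambda>w. (w, u)) ` graph_ball G u 1" (is "?I \<subseteq> _")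
proof
  fix e assume e: "e \<in> ?I"
  obtain x y where xy: "e = (x, y)"
    by (cases e)
  have u: "u \<in> graph_ball G u 0"
    using e arc_fst_in_verts arc_snd_in_verts by (intro centre_in_graph_ball) auto
  have "x = u \<and> y \<in> graph_ball G u (Suc 0) \<or> y = u \<and> x \<in> graph_ball G u (Suc 0)"
    using e xy neighbour_in_graph_ball_Suc[OF u] by auto
  then show "e \<in> Pair u ` graph_ball G u 1 \<union> (\<lambda>w. (w, u)) ` graph_ball G u 1"
    using xy by auto
qed

lemma finite_incident_arcs:
  assumes "finite (graph_ball G u 1)"
  shows "finite {e \<in> parcs G. fst e = u \<or> snd e = u}"
  by (rule finite_subset[OF incident_arcs_subset]) (use assms in simp)

lemma card_incident_arcs_le:
  assumes "finite (graph_ball G u 1)"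
  shows "card {e \<in> parcs G. fst e = u \<or> snd e = u} \<le> 2 * card (graph_ball G u 1)"
proof -
  have "card {e \<in> parcs G. fst e = u \<or> snd e = u}
      \<le> card (Pair u ` graph_ball G u 1 \<union> (\<lambda>w. (w, u)) ` graph_ball G u 1)"
    using assms by (intro card_mono incident_arcs_subset) auto
  also have "\<dots> \<le> card (Pair u ` graph_ball G u 1) + card ((\<lambda>w. (w, u)) ` graph_ball G u 1)"
    by (rule card_Un_le)
  also have "\<dots> \<le> 2 * card (graph_ball G u 1)"
    using card_image_le[OF assms, of "Pair u"] card_image_le[OF assms, of "\<lambda>w. (w, u)"] by simp
  finally show ?thesis .
qed

lemma finite_edge_boundary:
  assumes "finite A" and "\<And>u. u \<in> A \<Longrightarrow> finite (graph_ball G u 1)"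
  shows "finite (edge_boundary G A)"
proof (rule finite_subset)
  show "edge_boundary G A \<subseteq> (\<Union>u\<in>A. {e \<in> parcs G. fst e = u \<or> snd e = u})"
    by (auto simp: edge_boundary_def)
  show "finite (\<Union>u\<in>A. {e \<in> parcs G. fst e = u \<or> snd e = u})"
    using assms finite_incident_arcs by blast
qed

text \<open>The outer endpoint of a boundary arc lies in the sphere of radius \<open>Suc r\<close>,
  and each vertex there meets at most \<open>D\<close> arcs.\<close>

lemma card_edge_boundary_graph_ball_le:
  assumes fin: "finite (graph_ball G v (Suc r))"
    and fin1: "\<And>u. u \<in> pverts G \<Longrightarrow> finite (graph_ball G u 1)"
    and deg: "\<And>u. u \<in> pverts G \<Longrightarrow> 2 * card (graph_ball G u 1) \<le> D"
  shows "card (edge_boundary G (graph_ball G v r))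
    \<le> D * (card (graph_ball G v (Suc r)) - card (graph_ball G v r))"
proof -
  let ?S = "graph_ball G v (Suc r) - graph_ball G v r"
  let ?I = "\<lambda>u. {e \<in> parcs G. fst e = u \<or> snd e = u}"
  have sub: "graph_ball G v r \<subseteq> graph_ball G v (Suc r)"
    by (rule graph_ball_mono) simp
  have S: "u \<in> pverts G" if "u \<in> ?S" for u
    using that graph_ball_subset_verts by blast
  have bd: "edge_boundary G (graph_ball G v r) \<subseteq> (\<Union>u\<in>?S. ?I u)"
  proof
    fix e assume "e \<in> edge_boundary G (graph_ball G v r)"
    then have e: "e \<in> parcs G" "(fst e \<in> graph_ball G v r) \<noteq> (snd e \<in> graph_ball G v r)"
      by (auto simp: edge_boundary_def)
    obtain x y where xy: "e = (x, y)"
      by (cases e)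
    show "e \<in> (\<Union>u\<in>?S. ?I u)"
      using e xy neighbour_in_graph_ball_Suc[of x v r y] neighbour_in_graph_ball_Suc[of y v r x]
      by auto
  qed
  have "card (edge_boundary G (graph_ball G v r)) \<le> card (\<Union>u\<in>?S. ?I u)"
    using fin fin1 S finite_incident_arcs by (intro card_mono bd finite_UN_I) auto
  also have "\<dots> \<le> (\<Sum>u\<in>?S. card (?I u))"
    using fin by (intro card_UN_le) simp
  also have "\<dots> \<le> (\<Sum>u\<in>?S. D)"
    using S fin1 deg card_incident_arcs_le by (intro sum_mono) (blast intro: order_trans)
  also have "\<dots> = D * (card (graph_ball G v (Suc r)) - card (graph_ball G v r))"
    using fin sub by (simp add: card_Diff_subset finite_subset)
  finally show ?thesis .
qed

text \<open>By the preceding bound, each unit of radius adds at least \<open>x / D\<close> times the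
  current size, starting from a nonempty ball.\<close>

lemma card_graph_ball_ge_power:
  assumes v: "v \<in> pverts G" and "D > 0" "x \<ge> 0"
    and fin: "\<And>r. finite (graph_ball G v r)"
    and fin1: "\<And>u. u \<in> pverts G \<Longrightarrow> finite (graph_ball G u 1)"
    and deg: "\<And>u. u \<in> pverts G \<Longrightarrow> 2 * card (graph_ball G u 1) \<le> D"
    and x: "\<And>r. r < R \<Longrightarrow> x * real (card (graph_ball G v r)) \<le> real (card (edge_boundary G (graph_ball G v r)))"
  shows "(1 + x / real D) ^ R \<le> real (card (graph_ball G v R))"
  using x
proof (induction R)
  case 0
  have "card (graph_ball G v 0) > 0"
    using fin centre_in_graph_ball[OF v] card_gt_0_iff by blast
  then show ?case
    by simp
next
  case (Suc R)
  let ?c = "\<lambda>r. real (card (graph_ball G v r))"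
  have "card (graph_ball G v R) \<le> card (graph_ball G v (Suc R))"
    using fin by (intro card_mono graph_ball_mono) auto
  then have "real D * (?c (Suc R) - ?c R) = real (D * (card (graph_ball G v (Suc R)) - card (graph_ball G v R)))"
    by (simp add: of_nat_diff)
  moreover have "card (edge_boundary G (graph_ball G v R))
      \<le> D * (card (graph_ball G v (Suc R)) - card (graph_ball G v R))"
    using fin fin1 deg by (intro card_edge_boundary_graph_ball_le) auto
  ultimately have "x * ?c R \<le> real D * (?c (Suc R) - ?c R)"
    using Suc.prems[of R] by linarith
  then have step: "(1 + x / real D) * ?c R \<le> ?c (Suc R)"
    using \<open>D > 0\<close> by (simp add: field_simps)
  have "(1 + x / real D) ^ Suc R = (1 + x / real D) * (1 + x / real D) ^ R"
    by simp
  also have "\<dots> \<le> (1 + x / real D) * ?c R"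
    using Suc \<open>x \<ge> 0\<close> by (intro mult_left_mono) auto
  finally show ?case
    using step by simp
qed

section \<open>Elementary bounds on the separation profile\<close>

text \<open>A crude bound showing that the supremum in \<open>sep_profile\<close> is over a bounded
  set. A singleton competitor gives \<open>n ^ 2\<close>; the summand 1 covers the conventional
  value of \<open>cheeger\<close>.\<close>

lemma card_mult_cheeger_le:
  assumes "finite F" "card F \<le> n"
  shows "real (card F) * cheeger (G \<restriction> F) \<le> real n * (1 + real n ^ 2)"
proof -
  have "cheeger (G \<restriction> F) \<le> 1 + real n ^ 2"
  proof (cases "card F \<le> 1")
    case True
    then show ?thesis
      by (simp add: cheeger_def)
  next
    case False
    let ?\<A> = "{A. A \<subseteq> F \<and> A \<noteq> {} \<and> real (card A) \<le> real (card F) / 2}"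
    let ?f = "\<lambda>A. real (card (edge_boundary (G \<restriction> F) A)) / real (card A)"
    obtain x where x: "x \<in> F"
      using False \<open>finite F\<close> by fastforce
    have "cheeger (G \<restriction> F) = Min (?f ` ?\<A>)"
      using False by (simp add: cheeger_def)
    also have "\<dots> \<le> ?f {x}"
      using x False \<open>finite F\<close> by (intro Min_le imageI) auto
    also have "\<dots> = real (card (edge_boundary (G \<restriction> F) {x}))"
      by simp
    also have "\<dots> \<le> real (card (F \<times> F))"
      using \<open>finite F\<close> by (intro of_nat_mono card_mono) (auto simp: edge_boundary_def)
    also have "\<dots> = real (card F) ^ 2"
      by (simp add: card_cartesian_product power2_eq_square)
    also have "\<dots> \<le> 1 + real n ^ 2"
      using assms(2) by (simp add: power_mono add_increasing)
    finally show ?thesis .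
  qed
  then have "real (card F) * cheeger (G \<restriction> F) \<le> real (card F) * (1 + real n ^ 2)"
    by (intro mult_left_mono) auto
  also have "\<dots> \<le> real n * (1 + real n ^ 2)"
    using assms(2) by (intro mult_right_mono) auto
  finally show ?thesis .
qed

lemma sep_profile_ge:
  assumes "F \<subseteq> graph_ball G v r" "finite (graph_ball G v r)" "card (graph_ball G v r) \<le> n"
  shows "real (card F) * cheeger (G \<restriction> F) \<le> sep_profile G v n"
  unfolding sep_profile_def
proof (rule cSup_upper)
  show "bdd_above {real (card F) * cheeger (G \<restriction> F) | F.
      \<exists>r. F \<subseteq> graph_ball G v r \<and> finite (graph_ball G v r) \<and> card (graph_ball G v r) \<le> n}"
  proof (rule bdd_aboveI, safe)
    fix F r assume F: "F \<subseteq> graph_ball G v r" "finite (graph_ball G v r)" "card (graph_ball G v r) \<le> n"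
    then have "finite F" "card F \<le> n"
      using card_mono[OF F(2,1)] by (auto intro: finite_subset)
    then show "real (card F) * cheeger (G \<restriction> F) \<le> real n * (1 + real n ^ 2)"
      by (rule card_mult_cheeger_le)
  qed
qed (use assms in blast)

text \<open>A walk to another vertex has at least one arc. Radius 0 needs its own argument because
  the growth hypothesis starts at radius 1.\<close>

lemma graph_ball_0:
  assumes "v \<in> pverts G"
  shows "graph_ball G v 0 = {v}"
proof
  show "{v} \<subseteq> graph_ball G v 0"
    using centre_in_graph_ball[OF assms] by simp
  interpret S: pair_wf_digraph "mk_symmetric G"
    by (rule wellformed_mk_symmetric)
  have ge: "1 \<le> S.\<mu> (\<lambda>_. 1) v u" if "u \<noteq> v" for u
    unfolding S.\<mu>_def
  proof (rule INF_greatest)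
    fix p assume p: "p \<in> {p. S.awalk v p u}"
    then have "p \<noteq> []"
      using that by (auto simp: S.awalk_Nil_iff)
    moreover have "awalk_cost (\<lambda>_. 1) p = real (length p)" for p :: "('a \<times> 'a) list"
      by (induction p) auto
    ultimately show "1 \<le> ereal (awalk_cost (\<lambda>_. 1) p)"
      by (cases p) (auto simp: one_ereal_def)
  qed
  show "graph_ball G v 0 \<subseteq> {v}"
  proof
    fix u assume "u \<in> graph_ball G v 0"
    then have "S.\<mu> (\<lambda>_. 1) v u \<le> 0"
      by (simp add: graph_ball_def graph_dist_def zero_ereal_def)
    then show "u \<in> {v}"
      using ge[of u] order_trans[of 1 "S.\<mu> (\<lambda>_. 1) v u" 0] by auto
  qed
qed

text \<open>The set \<open>{v}\<close> contributes 1 by the convention in \<open>cheeger\<close>.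
  This settles the case \<open>d1 \<le> 1\<close> and all small \<open>n\<close>.\<close>

lemma sep_profile_ge_1:
  assumes "v \<in> pverts G" "n \<ge> 1"
  shows "1 \<le> sep_profile G v n"
  using sep_profile_ge[of "{v}" v 0 n] assms by (simp add: graph_ball_0 cheeger_def)

end

section \<open>Polynomial growth and decay of the ball profile\<close>

text \<open>Keep only the term of degree \<open>m\<close> in the binomial expansion, estimate
  \<open>R choose m\<close> from below by \<open>(R / m) ^ m\<close>, and take the
  \<open>m\<close>-th root.\<close>

lemma bound_of_power_one_plus_le:
  fixes x c :: real
  assumes "1 \<le> m" "m \<le> R" "0 \<le> x" and le: "(1 + x) ^ R \<le> c"
  shows "x \<le> real m / real R * c powr (1 / real m)"
proof -
  have "(real R / real m * x) ^ m = (real R / real m) ^ m * x ^ m"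
    by (rule power_mult_distrib)
  also have "\<dots> \<le> real (R choose m) * x ^ m"
    using assms binomial_ge_n_over_k_pow_k[of m R, where 'a = real]
    by (intro mult_right_mono) auto
  also have "\<dots> \<le> (\<Sum>k\<le>R. real (R choose k) * x ^ k * 1 ^ (R - k))"
    using assms(2,3) member_le_sum[of m "{..R}" "\<lambda>k. real (R choose k) * x ^ k"] by simp
  also have "\<dots> = (1 + x) ^ R"
    by (subst add.commute) (rule binomial_ring[symmetric])
  finally have *: "(real R / real m * x) ^ m \<le> c"
    using le by simp
  have "real R / real m * x = ((real R / real m * x) ^ m) powr (1 / real m)"
  proof (cases "x = 0")
    case False
    then have "real R / real m * x > 0"
      using assms by simp
    then show ?thesis
      using assms(1,3) by (simp add: powr_powr flip: powr_realpow)
  qed (use assms in simp)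
  also have "\<dots> \<le> c powr (1 / real m)"
    using * assms(3) by (intro powr_mono2) auto
  finally show ?thesis
    using assms by (simp add: field_simps)
qed

locale polynomial_pair_digraph = pair_wf_digraph +
  fixes b g d1 d2 :: real
  assumes b_pos: "b > 0" and g_pos: "g > 0" and d1_pos: "d1 > 0" and d2_pos: "d2 > 0"
    and finite_graph_ball_pos: "\<And>v n. v \<in> pverts G \<Longrightarrow> n \<ge> 1 \<Longrightarrow> finite (graph_ball G v n)"
    and card_graph_ball_le: "\<And>v n. v \<in> pverts G \<Longrightarrow> n \<ge> 1 \<Longrightarrow>
      real (card (graph_ball G v n)) \<le> b * real n powr d2"
    and isoperimetry: "\<And>V. V \<subseteq> pverts G \<Longrightarrow> finite V \<Longrightarrow> V \<noteq> {} \<Longrightarrow>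
      g * real (card V) powr ((d1 - 1) / d1) \<le> real (card (edge_boundary G V))"
begin

lemma finite_graph_ball:
  assumes "v \<in> pverts G"
  shows "finite (graph_ball G v r)"
proof (cases "r = 0")
  case True
  then show ?thesis
    using graph_ball_0[OF assms] by simp
next
  case False
  then show ?thesis
    by (intro finite_graph_ball_pos assms) simp
qed

lemma finite_edge_boundary_of_finite:
  assumes "A \<subseteq> pverts G" "finite A"
  shows "finite (edge_boundary G A)"
  using assms by (intro finite_edge_boundary finite_graph_ball) blast+

text \<open>This is \<open>\<phi>\<^sub>0\<close> of the overview: the size bound excludes nothing,
  so the minimum runs over all nonempty subsets of the ball.\<close>

definition ball_profile :: "'a \<Rightarrow> nat \<Rightarrow> real" where
  "ball_profile v R = local_iso_profile G (graph_ball G v R) (card (graph_ball G v R))"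

text \<open>A minimiser has at most \<open>b * R powr d2\<close> vertices, and the exponent
  \<open>- 1 / d1\<close> is negative.\<close>

lemma ball_profile_ge:
  assumes v: "v \<in> pverts G" and "R \<ge> 1"
  shows "g * (b * real R powr d2) powr (- 1 / d1) \<le> ball_profile v R"
proof -
  let ?B = "graph_ball G v R"
  have fin: "finite ?B" "?B \<noteq> {}"
    using finite_graph_ball[OF v] centre_in_graph_ball[OF v] by blast+
  then have "card ?B \<ge> 1"
    by (simp add: Suc_leI card_gt_0_iff)
  then obtain A where A: "A \<subseteq> ?B" "A \<noteq> {}" "ball_profile v R = iso_ratio G A"
    using local_iso_profile_attained[OF fin] unfolding ball_profile_def by metis
  then have "finite A" "A \<subseteq> pverts G"
    using fin graph_ball_subset_verts by (auto intro: finite_subset)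
  then have pos: "card A > 0"
    using A(2) by (simp add: card_gt_0_iff)
  have "real (card A) \<le> b * real R powr d2"
    using card_graph_ball_le[OF v \<open>R \<ge> 1\<close>] card_mono[OF fin(1) A(1)] by linarith
  then have "(b * real R powr d2) powr (- 1 / d1) \<le> real (card A) powr (- 1 / d1)"
    using pos d1_pos by (intro powr_mono2') auto
  then have "g * (b * real R powr d2) powr (- 1 / d1) \<le> g * real (card A) powr (- 1 / d1)"
    using g_pos by simp
  also have "\<dots> \<le> iso_ratio G A"
    using pos d1_pos \<open>finite A\<close> \<open>A \<subseteq> pverts G\<close> A(2) isoperimetry by (intro iso_ratio_ge) auto
  finally show ?thesis
    using A(3) by simp
qed

lemma ball_profile_pos:
  assumes "v \<in> pverts G" "R \<ge> 1"
  shows "0 < ball_profile v R"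
proof -
  have "0 < g * (b * real R powr d2) powr (- 1 / d1)"
    using g_pos b_pos assms(2) by simp
  then show ?thesis
    using ball_profile_ge[OF assms] by linarith
qed

text \<open>
  If every ball around \<open>v\<close> of radius less than \<open>R\<close> had a large relative boundary, the balls
  would grow geometrically up to radius \<open>R\<close>, contradicting the polynomial growth.
\<close>

lemma ball_profile_decay:
  assumes "\<epsilon> > 0"
  shows "\<exists>C>0. \<exists>m\<ge>1. \<forall>v\<in>pverts G. \<forall>R\<ge>m. ball_profile v R \<le> C * real R powr (\<epsilon> - 1)"
proof -
  define D where "D = nat \<lceil>2 * b\<rceil>"
  have D: "D > 0"
    using b_pos by (simp add: D_def)
  \<comment> \<open>With \<open>d2 / m \<le> \<epsilon>\<close>, the \<open>m\<close>-th root of the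
    volume bound costs at most a factor of order \<open>R powr \<epsilon>\<close>; \<open>m\<close>
    does not depend on \<open>R\<close> or \<open>v\<close>.\<close>
  define m where "m = Suc (nat \<lceil>d2 / \<epsilon>\<rceil>)"
  have m: "m \<ge> 1" "d2 / \<epsilon> \<le> real m"
    by (simp_all add: m_def) linarith
  have deg: "2 * card (graph_ball G u 1) \<le> D" if "u \<in> pverts G" for u
  proof -
    have "real (2 * card (graph_ball G u 1)) \<le> 2 * b"
      using card_graph_ball_le[OF that, of 1] by simp
    then show ?thesis
      unfolding D_def by linarith
  qed
  define C where "C = real D * real m * b powr (1 / real m)"
  have "C > 0"
    using D m b_pos by (simp add: C_def)
  moreover have "ball_profile v R \<le> C * real R powr (\<epsilon> - 1)" if v: "v \<in> pverts G" and R: "m \<le> R" for v R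
  proof -
    have "R \<ge> 1"
      using R m by simp
    define x where "x = ball_profile v R"
    have "x > 0"
      using ball_profile_pos[OF v \<open>R \<ge> 1\<close>] by (simp add: x_def)
    have "(1 + x / real D) ^ R \<le> real (card (graph_ball G v R))"
    proof (rule card_graph_ball_ge_power[OF v D])
      fix r assume "r < R"
      then have sub: "graph_ball G v r \<subseteq> graph_ball G v R"
        by (intro graph_ball_mono) simp
      have "graph_ball G v r \<noteq> {}"
        using centre_in_graph_ball[OF v] by blast
      moreover from this have "card (graph_ball G v r) > 0"
        using finite_graph_ball[OF v] by (simp add: card_gt_0_iff)
      \<comment> \<open>Each smaller ball is itself a competitor in the minimum
        \<open>x\<close>.\<close>
      ultimately show "x * real (card (graph_ball G v r)) \<le> real (card (edge_boundary G (graph_ball G v r)))"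
        using local_iso_profile_le[OF finite_graph_ball[OF v] sub, of "card (graph_ball G v R)" G]
          card_mono[OF finite_graph_ball[OF v] sub]
        by (simp add: x_def ball_profile_def iso_ratio_def pos_le_divide_eq)
    qed (use \<open>x > 0\<close> v finite_graph_ball deg in auto)
    also have "\<dots> \<le> b * real R powr d2"
      by (rule card_graph_ball_le[OF v \<open>R \<ge> 1\<close>])
    finally have "x / real D \<le> real m / real R * (b * real R powr d2) powr (1 / real m)"
      using m R \<open>x > 0\<close> by (intro bound_of_power_one_plus_le) auto
    also have "(b * real R powr d2) powr (1 / real m) = b powr (1 / real m) * real R powr (d2 / real m)"
      using b_pos by (simp add: powr_mult powr_powr)
    also have "real m / real R * (b powr (1 / real m) * real R powr (d2 / real m))
        = real m * b powr (1 / real m) * real R powr (d2 / real m - 1)"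
      using \<open>R \<ge> 1\<close> by (simp add: powr_diff)
    also have "\<dots> \<le> real m * b powr (1 / real m) * real R powr (\<epsilon> - 1)"
    proof (intro mult_left_mono powr_mono)
      show "d2 / real m - 1 \<le> \<epsilon> - 1"
        using m assms by (simp add: field_simps)
    qed (use \<open>R \<ge> 1\<close> in auto)
    finally have "x \<le> real D * (real m * b powr (1 / real m) * real R powr (\<epsilon> - 1))"
      using D by (simp add: field_simps)
    then show ?thesis
      by (simp add: x_def C_def mult.assoc)
  qed
  ultimately show ?thesis
    using m(1) by blast
qed

text \<open>If \<open>d1 > d2\<close>, the lower bound of order \<open>R powr (- d2 / d1)\<close> on
  \<open>ball_profile\<close> eventually exceeds the upper bound of order
  \<open>R powr (\<epsilon> - 1)\<close>. A vertex is needed, since the empty graph satisfies the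
  hypotheses for all dimensions.\<close>

lemma isoperimetric_dim_le_growth_dim:
  assumes "pverts G \<noteq> {}"
  shows "d1 \<le> d2"
proof (rule ccontr)
  assume "\<not> d1 \<le> d2"
  \<comment> \<open>Half of the gap between the two exponents, so that
    \<open>\<epsilon> - 1 = - \<epsilon> - d2 / d1\<close>.\<close>
  define \<epsilon> where "\<epsilon> = (1 - d2 / d1) / 2"
  have "\<epsilon> > 0"
    using \<open>\<not> d1 \<le> d2\<close> d1_pos by (simp add: \<epsilon>_def field_simps)
  from assms obtain v where v: "v \<in> pverts G"
    by blast
  obtain C m where C: "C > 0" "m \<ge> 1" "\<forall>v\<in>pverts G. \<forall>R\<ge>m. ball_profile v R \<le> C * real R powr (\<epsilon> - 1)"
    using ball_profile_decay[OF \<open>\<epsilon> > 0\<close>] by blast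
  have le: "g * b powr (- 1 / d1) \<le> C * real R powr (- \<epsilon>)" if "R \<ge> m" for R
  proof -
    have R: "R \<ge> 1" "real R > 0"
      using that C(2) by auto
    have "g * b powr (- 1 / d1) * real R powr (- d2 / d1) = g * (b * real R powr d2) powr (- 1 / d1)"
      using b_pos by (simp add: powr_mult powr_powr)
    also have "\<dots> \<le> C * real R powr (\<epsilon> - 1)"
      using ball_profile_ge[OF v R(1)] C(3) v that by force
    also have "\<epsilon> - 1 = - \<epsilon> + (- d2 / d1)"
      by (simp add: \<epsilon>_def field_simps)
    also have "C * real R powr (- \<epsilon> + (- d2 / d1)) = C * real R powr (- \<epsilon>) * real R powr (- d2 / d1)"
      by (simp only: powr_add mult.assoc)
    finally show ?thesis
      using R(2) by simp
  qed
  have "((\<lambda>R. C * real R powr (- \<epsilon>)) \<longlongrightarrow> 0) sequentially"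
    using \<open>\<epsilon> > 0\<close> by real_asymp
  then have "\<forall>\<^sub>F R in sequentially. C * real R powr (- \<epsilon>) < g * b powr (- 1 / d1)"
    using g_pos b_pos by (intro order_tendstoD) auto
  then have "\<forall>\<^sub>F R in sequentially. False"
    using eventually_ge_at_top[of m] by eventually_elim (use le in force)
  then show False
    by simp
qed

section \<open>From the ball profile to the separation profile\<close>

text \<open>The dyadic argument inside a ball of at most \<open>n\<close> vertices, with
  \<open>J\<close> the rounded-up binary logarithm of \<open>n\<close>. For \<open>d1 > 1\<close>
  the power \<open>1 - d1\<close> turns decay of \<open>ball_profile\<close> into growth.\<close>

lemma sep_profile_ge_ball_profile:
  assumes v: "v \<in> pverts G" and "R \<ge> 1" "n \<ge> 1"
    and n: "b * real R powr d2 \<le> real n"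
    and small: "ball_profile v R \<le> g / 2" "ball_profile v R \<le> 1"
  shows "(g / 2) powr d1 * ball_profile v R powr (1 - d1) / (2 * real (nat \<lceil>log 2 n\<rceil>)) \<le> sep_profile G v n"
proof -
  let ?B = "graph_ball G v R" and ?J = "nat \<lceil>log 2 n\<rceil>"
  have fin: "finite ?B" "?B \<noteq> {}"
    using finite_graph_ball[OF v] centre_in_graph_ball[OF v] by blast+
  have sub: "?B \<subseteq> pverts G"
    by (rule graph_ball_subset_verts)
  have cB: "card ?B \<le> n"
    using card_graph_ball_le[OF v \<open>R \<ge> 1\<close>] n by linarith
  have "real n = 2 powr (log 2 n)"
    using \<open>n \<ge> 1\<close> by simp
  also have "\<dots> \<le> 2 powr real ?J"
    by (intro powr_mono) linarith+
  also have "\<dots> = real (2 ^ ?J)"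
    by (simp add: powr_realpow)
  finally have "n \<le> 2 ^ ?J"
    by (simp only: of_nat_le_iff)
  define x where "x = ball_profile v R"
  have "x > 0"
    using ball_profile_pos[OF v \<open>R \<ge> 1\<close>] by (simp add: x_def)
  have "\<exists>F\<subseteq>?B. (g / (2 * x)) powr d1 * (x / (2 * real ?J)) \<le> real (card F) * cheeger (G \<restriction> F)"
  proof (rule exists_subset_cheeger_ge[OF fin _ d1_pos g_pos])
    show "card ?B \<le> 2 ^ ?J"
      using cB \<open>n \<le> 2 ^ ?J\<close> by simp
  next
    fix A assume "A \<subseteq> ?B"
    then have A: "finite A" "A \<subseteq> pverts G"
      using fin(1) sub finite_subset by auto
    then show "finite (edge_boundary G A)"
      by (intro finite_edge_boundary_of_finite)
    show "g * real (card A) powr ((d1 - 1) / d1) \<le> real (card (edge_boundary G A))" if "A \<noteq> {}"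
      using A that by (intro isoperimetry)
  qed (use small in \<open>auto simp: x_def ball_profile_def\<close>)
  then obtain F where F: "F \<subseteq> ?B"
    "(g / (2 * x)) powr d1 * (x / (2 * real ?J)) \<le> real (card F) * cheeger (G \<restriction> F)"
    by blast
  have "(g / 2) powr d1 * x powr (1 - d1) / (2 * real ?J) = (g / 2 / x) powr d1 * (x / (2 * real ?J))"
    using \<open>x > 0\<close> g_pos by (simp only: powr_divide powr_diff) simp
  also have "g / 2 / x = g / (2 * x)"
    by simp
  also note F(2)
  also have "real (card F) * cheeger (G \<restriction> F) \<le> sep_profile G v n"
    using sep_profile_ge[OF F(1) fin(1) cB] .
  finally show ?thesis
    by (simp add: x_def)
qed

text \<open>Take the largest radius with \<open>b * R powr d2 \<le> n\<close> and insert the decay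
  of \<open>ball_profile\<close>. The constants are uniform in \<open>v\<close>.\<close>

lemma sep_profile_ge_eventually:
  assumes d1: "d1 > 1" and "0 < \<eta>" "\<eta> < 1"
  shows "\<exists>c>0. \<forall>\<^sub>F n in sequentially. \<forall>v\<in>pverts G.
    c * real n powr ((1 - \<eta>) * (d1 - 1) / d2) \<le> sep_profile G v n"
proof -
  \<comment> \<open>The loss \<open>\<eta>\<close> is split in two: \<open>\<epsilon>\<close> pays
    for the decay estimate, \<open>\<delta>\<close> for the logarithm in the denominator.\<close>
  define \<epsilon> where "\<epsilon> = \<eta> / 2"
  define \<delta> where "\<delta> = \<eta> * (d1 - 1) / (2 * d2)"
  have \<epsilon>: "\<epsilon> > 0" "\<epsilon> < 1" and "\<delta> > 0"
    using assms d2_pos by (auto simp: \<epsilon>_def \<delta>_def)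
  obtain C m where C: "C > 0" "m \<ge> 1" "\<And>v R. v \<in> pverts G \<Longrightarrow> R \<ge> m \<Longrightarrow> ball_profile v R \<le> C * real R powr (\<epsilon> - 1)"
    using ball_profile_decay[OF \<epsilon>(1)] by blast
  define p where "p = (1 - \<epsilon>) * (d1 - 1)"
  have "p > 0"
    using \<epsilon> d1 by (simp add: p_def)
  define R where "R n = nat \<lfloor>(real n / b) powr (1 / d2)\<rfloor>" for n :: nat
  \<comment> \<open>From \<open>ln n \<le> n powr \<delta> / \<delta>\<close>, with the final 1 for
    rounding the logarithm up.\<close>
  define M where "M = 1 / (\<delta> * ln 2) + 1"
  have "M > 0"
    using \<open>\<delta> > 0\<close> by (simp add: M_def add_pos_pos)
  define K where "K = (g / 2) powr d1 * C powr (1 - d1)"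
  have "K > 0"
    using C(1) g_pos by (simp add: K_def)
  \<comment> \<open>Chosen so that \<open>L * n powr (p / d2)\<close> is
    \<open>(t / 2) powr p\<close>, where \<open>t\<close> is the radius before rounding
    down.\<close>
  define L where "L = (1 / 2) powr p * (1 / b) powr (p / d2)"
  have "L > 0"
    using b_pos by (simp add: L_def)
  define c where "c = K * L / (2 * M)"
  have "c > 0"
    using \<open>K > 0\<close> \<open>L > 0\<close> \<open>M > 0\<close> by (simp add: c_def)
  have "filterlim (\<lambda>n. (real n / b) powr (1 / d2)) at_top sequentially"
    using b_pos d2_pos by real_asymp
  then have R_top: "filterlim R sequentially sequentially"
    unfolding R_def
    by (intro filterlim_compose[OF filterlim_nat_sequentially] filterlim_compose[OF filterlim_floor_sequentially])
  have "((\<lambda>R. C * real R powr (\<epsilon> - 1)) \<longlongrightarrow> 0) sequentially"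
    using \<epsilon> by real_asymp
  then have "\<forall>\<^sub>F R in sequentially. C * real R powr (\<epsilon> - 1) < min 1 (g / 2)"
    using g_pos by (intro order_tendstoD) auto
  then have ev1: "\<forall>\<^sub>F n in sequentially. C * real (R n) powr (\<epsilon> - 1) < min 1 (g / 2)"
    by (rule eventually_compose_filterlim[OF _ R_top])
  have ev2: "\<forall>\<^sub>F n in sequentially. m \<le> R n"
    by (rule eventually_compose_filterlim[OF eventually_ge_at_top R_top])
  have "\<forall>\<^sub>F n in sequentially. \<forall>v\<in>pverts G. c * real n powr ((1 - \<eta>) * (d1 - 1) / d2) \<le> sep_profile G v n"
    using ev1 ev2 eventually_ge_at_top[of 2]
  proof eventually_elim
    case (elim n)
    let ?J = "nat \<lceil>log 2 n\<rceil>"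
    define t where "t = (real n / b) powr (1 / d2)"
    have R: "R n \<ge> 1" "real (R n) > 0"
      using elim(2) C(2) by auto
    then have "t \<ge> 1"
      by (simp add: R_def t_def)
    \<comment> \<open>Rounding down a real number that is at least 1 loses at most half of
      it.\<close>
    then have Rt: "real (R n) \<le> t" "t / 2 \<le> real (R n)"
      using R by (auto simp: R_def simp flip: t_def) linarith
    have "b * real (R n) powr d2 \<le> b * t powr d2"
      using Rt(1) b_pos d2_pos by (intro mult_left_mono powr_mono2) auto
    also have "\<dots> = real n"
      using b_pos d2_pos by (simp add: t_def powr_powr)
    finally have ball_n: "b * real (R n) powr d2 \<le> real n" .
    have J_pos: "real ?J > 0"
      using elim(3) by simp
    have "real ?J \<le> log 2 n + 1"
      using elim(3) by (simp add: of_nat_nat)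
    also have "\<dots> = ln n / ln 2 + 1"
      by (simp add: log_def)
    also have "\<dots> \<le> (real n powr \<delta> / \<delta>) / ln 2 + real n powr \<delta>"
      using elim(3) \<open>\<delta> > 0\<close> by (intro add_mono divide_right_mono ln_powr_bound ge_one_powr_ge_zero) auto
    also have "\<dots> = M * real n powr \<delta>"
      using \<open>\<delta> > 0\<close> by (simp add: M_def field_simps)
    finally have J: "real ?J \<le> M * real n powr \<delta>" .
    have "L * real n powr (p / d2) = (t / 2) powr p"
      using b_pos by (simp add: L_def t_def powr_divide powr_mult powr_powr)
    also have "\<dots> \<le> real (R n) powr p"
      using Rt \<open>t \<ge> 1\<close> \<open>p > 0\<close> by (intro powr_mono2) auto
    finally have LR: "L * real n powr (p / d2) \<le> real (R n) powr p" .
    have exps: "(1 - \<eta>) * (d1 - 1) / d2 = p / d2 - \<delta>"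
      using d2_pos by (simp add: p_def \<epsilon>_def \<delta>_def field_simps)
    show ?case
    proof
      fix v assume v: "v \<in> pverts G"
      define x where "x = ball_profile v (R n)"
      have x: "0 < x" "x \<le> C * real (R n) powr (\<epsilon> - 1)"
        using C(3)[OF v elim(2)] ball_profile_pos[OF v R(1)] by (auto simp: x_def)
      have "C powr (1 - d1) * real (R n) powr p = (C * real (R n) powr (\<epsilon> - 1)) powr (1 - d1)"
        using C(1) by (simp add: powr_mult powr_powr p_def algebra_simps)
      also have "\<dots> \<le> x powr (1 - d1)"
        using x d1 by (intro powr_mono2') auto
      finally have "K * real (R n) powr p \<le> (g / 2) powr d1 * x powr (1 - d1)"
        by (simp add: K_def mult.assoc mult_left_mono)
      moreover have "K * (L * real n powr (p / d2)) \<le> K * real (R n) powr p"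
        using LR \<open>K > 0\<close> by simp
      ultimately have num: "K * (L * real n powr (p / d2)) \<le> (g / 2) powr d1 * x powr (1 - d1)"
        by linarith
      have "c * real n powr ((1 - \<eta>) * (d1 - 1) / d2) = K * (L * real n powr (p / d2)) / (2 * (M * real n powr \<delta>))"
        by (simp add: c_def exps powr_diff)
      also have "\<dots> \<le> (g / 2) powr d1 * x powr (1 - d1) / (2 * real ?J)"
        using num J J_pos by (intro frac_le) auto
      also have "\<dots> \<le> sep_profile G v n"
        unfolding x_def using elim x(2) by (intro sep_profile_ge_ball_profile v R ball_n) (auto simp: x_def)
      finally show "c * real n powr ((1 - \<eta>) * (d1 - 1) / d2) \<le> sep_profile G v n" .
    qed
  qed
  then show ?thesis
    using \<open>c > 0\<close> by blast
qed

end

section \<open>The claimed exponent, for every positive \<open>n\<close>\<close>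

theorem theorem1p3:
  fixes G :: "'a pair_pre_digraph" and d1 d2 \<eta> :: real
  assumes "pair_wf_digraph G"
    and "d1 > 0" and "d2 > 0"
    and "polynomial_graph d1 d2 (with_proj G)"
    and "0 < \<eta>" and "\<eta> < 1"
  shows "\<exists>c>0. \<forall>v\<in>pverts G. \<forall>n::nat. n \<ge> 1 \<longrightarrow>
           sep_profile (with_proj G) v n
             \<ge> c * real n powr ((1 - \<eta>) * (d1\<^sup>2 * (d1 - 1) / d2 ^ 3))"
proof -
  obtain b g where "b > 0" "g > 0"
    and ball: "\<forall>v\<in>verts (with_proj G). \<forall>n::nat. n \<ge> 1 \<longrightarrow>
           finite (graph_ball G v n) \<and> real (card (graph_ball G v n)) \<le> b * real n powr d2"
    and iso: "\<forall>V\<subseteq>verts (with_proj G). finite V \<and> V \<noteq> {} \<longrightarrow>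
           real (card (edge_boundary G V)) \<ge> g * real (card V) powr ((d1 - 1) / d1)"
    using assms(4) unfolding polynomial_graph_def by blast
  interpret pair_wf_digraph G
    by fact
  interpret polynomial_pair_digraph G b g d1 d2
    using \<open>b > 0\<close> \<open>g > 0\<close> assms(2,3) ball iso by unfold_locales auto
  define \<alpha> where "\<alpha> = (1 - \<eta>) * (d1\<^sup>2 * (d1 - 1) / d2 ^ 3)"
  \<comment> \<open>For \<open>d1 \<le> 1\<close> the exponent is at most 0; the empty graph is set
    apart because \<open>d1 \<le> d2\<close> may fail there.\<close>
  consider "d1 \<le> 1" | "pverts G = {}" | "d1 > 1" "pverts G \<noteq> {}"
    by fastforce
  then have "\<exists>c>0. \<forall>v\<in>pverts G. \<forall>n::nat. n \<ge> 1 \<longrightarrow> c * real n powr \<alpha> \<le> sep_profile G v n"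
  proof cases
    case 1
    then have "d1\<^sup>2 * (d1 - 1) / d2 ^ 3 \<le> 0"
      using assms(3) by (intro divide_nonpos_nonneg mult_nonneg_nonpos) auto
    then have "\<alpha> \<le> 0"
      unfolding \<alpha>_def using assms(6) by (intro mult_nonneg_nonpos) auto
    have "1 * real n powr \<alpha> \<le> sep_profile G v n" if "v \<in> pverts G" "n \<ge> 1" for v n
    proof -
      have "real n powr \<alpha> \<le> real n powr 0"
        using \<open>\<alpha> \<le> 0\<close> that(2) by (intro powr_mono) auto
      then show ?thesis
        using sep_profile_ge_1[OF that] that(2) by simp
    qed
    then show ?thesis
      by (intro exI[of _ 1]) auto
  next
    case 2
    then show ?thesis
      by (intro exI[of _ 1]) auto
  next
    case 3
    \<comment> \<open>The exponent actually obtained; it dominates \<open>\<alpha>\<close> because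
      \<open>d1\<^sup>2 / d2 ^ 3 \<le> 1 / d2\<close>.\<close>
    define \<gamma> where "\<gamma> = (1 - \<eta>) * (d1 - 1) / d2"
    have "d1\<^sup>2 \<le> d2\<^sup>2"
      using isoperimetric_dim_le_growth_dim[OF 3(2)] assms(2) by (intro power_mono) auto
    then have "(1 - \<eta>) * (d1 - 1) * d1\<^sup>2 / d2 ^ 3 \<le> (1 - \<eta>) * (d1 - 1) * d2\<^sup>2 / d2 ^ 3"
      using 3(1) assms by (intro divide_right_mono mult_left_mono) auto
    also have "\<dots> = \<gamma>"
      using assms(3) by (simp add: \<gamma>_def power2_eq_square power3_eq_cube)
    finally have "\<alpha> \<le> \<gamma>"
      by (simp add: \<alpha>_def mult_ac)
    have "\<gamma> > 0"
      using 3(1) assms by (simp add: \<gamma>_def)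
    obtain c N where c: "c > 0"
      "\<And>n v. n \<ge> N \<Longrightarrow> v \<in> pverts G \<Longrightarrow> c * real n powr \<gamma> \<le> sep_profile G v n"
      using sep_profile_ge_eventually[OF 3(1) assms(5,6)]
      unfolding eventually_sequentially \<gamma>_def by blast
    \<comment> \<open>The second entry makes the bound at most 1 for \<open>n < N\<close>, where a
      single vertex suffices; \<open>Suc N\<close> keeps it positive when
      \<open>N = 0\<close>.\<close>
    define c' where "c' = min c (real (Suc N) powr (- \<gamma>))"
    have "c' > 0"
      using c(1) by (simp add: c'_def)
    moreover have "c' * real n powr \<alpha> \<le> sep_profile G v n" if v: "v \<in> pverts G" and n: "n \<ge> 1" for v n
    proof -
      have "c' * real n powr \<alpha> \<le> c' * real n powr \<gamma>"
        using \<open>\<alpha> \<le> \<gamma>\<close> n \<open>c' > 0\<close> by (intro mult_left_mono powr_mono) auto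
      also have "\<dots> \<le> sep_profile G v n"
      proof (cases "n \<ge> N")
        case True
        have "c' * real n powr \<gamma> \<le> c * real n powr \<gamma>"
          by (intro mult_right_mono) (auto simp: c'_def)
        then show ?thesis
          using c(2)[OF True v] by linarith
      next
        case False
        have "c' * real n powr \<gamma> \<le> real (Suc N) powr (- \<gamma>) * real (Suc N) powr \<gamma>"
          using False \<open>\<gamma> > 0\<close> by (intro mult_mono powr_mono2) (auto simp: c'_def)
        also have "\<dots> = 1"
          by (simp flip: powr_add)
        finally show ?thesis
          using sep_profile_ge_1[OF v n] by linarith
      qed
      finally show ?thesis .
    qed
    ultimately show ?thesis
      by blast
  qed
  then show ?thesis
    by (simp add: \<alpha>_def)
qed

end
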